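(* Let $d\ge2$, let $K$ be the covariance kernel of a Gaussian process indexed by the unit sphere $\mathbb{S}^{d-1}$, let $Q:[0,1]^{d-1}\to\mathbb{S}^{d-1}$ be a surjection, and define the kernel $G(s_1,s_2)=K(Qs_1,Qs_2)$ for $s_1,s_2\in[0,1]^{d-1}$. Let $(\mathbb{H},\|\cdot\|_{\mathbb{H}})$ be the RKHS of the Gaussian process with kernel $K$ and $(\mathbb{H}',\|\cdot\|_{\mathbb{H}'})$ the RKHS of the Gaussian process with kernel $G$. Then $(\mathbb{H}',\|\cdot\|_{\mathbb{H}'})$ and $(\mathbb{H},\|\cdot\|_{\mathbb{H}})$ are isometric; the conclusion also holds when the $\|\cdot\|_\infty$ norm is used on both spaces.
   Context: RKHS means reproducing kernel Hilbert space. $\|\cdot\|_\infty$ is the supremum norm of functions on the respective index set. *)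

theory Defs
  imports "HOL-Probability.Probability"
begin

section \<open>Gaussian processes\<close>

text \<open>Degenerate (constant) normal variables are admitted; \<open>normal_density\<close> is only a density
  for \<open>\<sigma> > 0\<close>.\<close>

definition gaussian_rv :: "'w measure \<Rightarrow> ('w \<Rightarrow> real) \<Rightarrow> bool" where
  "gaussian_rv M X \<longleftrightarrow> X \<in> borel_measurable M \<and>
     ((\<exists>\<mu>. distr M borel X = return borel \<mu>) \<or>
      (\<exists>\<mu> \<sigma>. \<sigma> > 0 \<and> distributed M lborel X (\<lambda>x. ennreal (normal_density \<mu> \<sigma> x))))"

definition gaussian_process :: "'w measure \<Rightarrow> 'i set \<Rightarrow> ('i \<Rightarrow> 'w \<Rightarrow> real) \<Rightarrow> bool" where
  "gaussian_process M T W \<longleftrightarrow> prob_space M \<and>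
     (\<forall>F c. finite F \<longrightarrow> F \<subseteq> T \<longrightarrow> gaussian_rv M (\<lambda>\<omega>. \<Sum>t\<in>F. c t * W t \<omega>))"

definition covariance :: "'w measure \<Rightarrow> ('w \<Rightarrow> real) \<Rightarrow> ('w \<Rightarrow> real) \<Rightarrow> real" where
  "covariance M X Y = (\<integral>\<omega>. (X \<omega> - (\<integral>\<omega>'. X \<omega>' \<partial>M)) * (Y \<omega> - (\<integral>\<omega>'. Y \<omega>' \<partial>M)) \<partial>M)"

definition has_covariance_kernel ::
    "'w measure \<Rightarrow> 'i set \<Rightarrow> ('i \<Rightarrow> 'w \<Rightarrow> real) \<Rightarrow> ('i \<Rightarrow> 'i \<Rightarrow> real) \<Rightarrow> bool" where
  "has_covariance_kernel M T W K \<longleftrightarrow> (\<forall>s\<in>T. \<forall>t\<in>T. K s t = covariance M (W s) (W t))"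


section \<open>The reproducing kernel Hilbert space\<close>

text \<open>A finitely supported coefficient function \<open>a\<close> on \<open>T\<close> represents the function
  \<open>\<Sum>s. a s * K s \<cdot>\<close>. The RKHS is the completion of the space of these functions under the inner
  product with \<open>\<langle>K s \<cdot>, K t \<cdot>\<rangle> = K s t\<close>, realised as a space of functions on \<open>T\<close>: an element is the
  pointwise limit of a Cauchy sequence of such combinations, and its norm is the limit of their
  norms. Functions on \<open>T\<close> are represented by functions on the whole type that vanish
  outside \<open>T\<close>.\<close>

definition fin_coeffs :: "'i set \<Rightarrow> ('i \<Rightarrow> real) set" where
  "fin_coeffs T = {a. finite {s. a s \<noteq> 0} \<and> {s. a s \<noteq> 0} \<subseteq> T}"

definition kernel_comb :: "('i \<Rightarrow> 'i \<Rightarrow> real) \<Rightarrow> ('i \<Rightarrow> real) \<Rightarrow> 'i \<Rightarrow> real" where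
  "kernel_comb K a t = (\<Sum>s | a s \<noteq> 0. a s * K s t)"

definition kernel_ip :: "('i \<Rightarrow> 'i \<Rightarrow> real) \<Rightarrow> ('i \<Rightarrow> real) \<Rightarrow> ('i \<Rightarrow> real) \<Rightarrow> real" where
  "kernel_ip K a b = (\<Sum>s | a s \<noteq> 0. \<Sum>t | b t \<noteq> 0. a s * b t * K s t)"

definition kernel_norm :: "('i \<Rightarrow> 'i \<Rightarrow> real) \<Rightarrow> ('i \<Rightarrow> real) \<Rightarrow> real" where
  "kernel_norm K a = sqrt (kernel_ip K a a)"

definition rkhs_approx ::
    "'i set \<Rightarrow> ('i \<Rightarrow> 'i \<Rightarrow> real) \<Rightarrow> (nat \<Rightarrow> 'i \<Rightarrow> real) \<Rightarrow> ('i \<Rightarrow> real) \<Rightarrow> bool" where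
  "rkhs_approx T K a f \<longleftrightarrow>
     (\<forall>n. a n \<in> fin_coeffs T) \<and>
     (\<forall>\<epsilon>>0. \<exists>N. \<forall>m\<ge>N. \<forall>n\<ge>N. kernel_norm K (\<lambda>s. a m s - a n s) < \<epsilon>) \<and>
     (\<forall>t\<in>T. (\<lambda>n. kernel_comb K (a n) t) \<longlonglongrightarrow> f t) \<and>
     (\<forall>t. t \<notin> T \<longrightarrow> f t = 0)"

definition rkhs :: "'i set \<Rightarrow> ('i \<Rightarrow> 'i \<Rightarrow> real) \<Rightarrow> ('i \<Rightarrow> real) set" where
  "rkhs T K = {f. \<exists>a. rkhs_approx T K a f}"

text \<open>For covariance kernels the limit exists and does not depend on the approximating
  sequence; see \<open>rkhs_norm_limit\<close> below.\<close>

definition rkhs_norm :: "'i set \<Rightarrow> ('i \<Rightarrow> 'i \<Rightarrow> real) \<Rightarrow> ('i \<Rightarrow> real) \<Rightarrow> real" where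
  "rkhs_norm T K f = (THE r. \<exists>a. rkhs_approx T K a f \<and> (\<lambda>n. kernel_norm K (a n)) \<longlonglongrightarrow> r)"


section \<open>Supremum norm and isometry\<close>

text \<open>Covariance kernels are not assumed bounded, so RKHS functions may be unbounded and the
  supremum norm takes values in \<open>[0, \<infinity>]\<close>.\<close>

definition sup_norm :: "'i set \<Rightarrow> ('i \<Rightarrow> real) \<Rightarrow> ennreal" where
  "sup_norm T f = (SUP t\<in>T. ennreal \<bar>f t\<bar>)"

text \<open>\<open>V\<close> and \<open>V'\<close> are linear spaces of functions with norms \<open>N\<close> and \<open>N'\<close>; an isometry is a linear
  bijection that preserves norms, hence also distances.\<close>

definition isometric ::
    "('i \<Rightarrow> real) set \<Rightarrow> (('i \<Rightarrow> real) \<Rightarrow> 'c) \<Rightarrow> ('j \<Rightarrow> real) set \<Rightarrow> (('j \<Rightarrow> real) \<Rightarrow> 'c) \<Rightarrow> bool" where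
  "isometric V N V' N' \<longleftrightarrow>
     (\<exists>\<Phi>. bij_betw \<Phi> V V' \<and>
          (\<forall>f\<in>V. \<forall>g\<in>V. \<forall>\<alpha> \<beta>.
             \<Phi> (\<lambda>x. \<alpha> * f x + \<beta> * g x) = (\<lambda>y. \<alpha> * \<Phi> f y + \<beta> * \<Phi> g y)) \<and>
          (\<forall>f\<in>V. N' (\<Phi> f) = N f))"


section \<open>Well-definedness\<close>

definition psd_kernel :: "'i set \<Rightarrow> ('i \<Rightarrow> 'i \<Rightarrow> real) \<Rightarrow> bool" where
  "psd_kernel T K \<longleftrightarrow> (\<forall>s\<in>T. \<forall>t\<in>T. K s t = K t s) \<and> (\<forall>a\<in>fin_coeffs T. 0 \<le> kernel_ip K a a)"

lemma kernel_ip_superset: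
  assumes "finite S" "{s. a s \<noteq> 0} \<subseteq> S" "{s. b s \<noteq> 0} \<subseteq> S"
  shows "kernel_ip K a b = (\<Sum>s\<in>S. \<Sum>t\<in>S. a s * b t * K s t)"
proof -
  have "kernel_ip K a b = (\<Sum>s | a s \<noteq> 0. \<Sum>t\<in>S. a s * b t * K s t)"
    unfolding kernel_ip_def using assms
    by (intro sum.cong refl sum.mono_neutral_left) auto
  also have "\<dots> = (\<Sum>s\<in>S. \<Sum>t\<in>S. a s * b t * K s t)"
    using assms by (intro sum.mono_neutral_left) auto
  finally show ?thesis .
qed

lemma kernel_comb_superset:
  assumes "finite S" "{s. a s \<noteq> 0} \<subseteq> S"
  shows "kernel_comb K a t = (\<Sum>s\<in>S. a s * K s t)"
  unfolding kernel_comb_def using assms by (intro sum.mono_neutral_left) auto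

lemma fin_coeffs_lincomb:
  assumes "a \<in> fin_coeffs T" "b \<in> fin_coeffs T"
  shows "(\<lambda>s. \<alpha> * a s + \<beta> * b s) \<in> fin_coeffs T"
proof -
  have "{s. \<alpha> * a s + \<beta> * b s \<noteq> 0} \<subseteq> {s. a s \<noteq> 0} \<union> {s. b s \<noteq> 0}" by auto
  moreover have "finite ({s. a s \<noteq> 0} \<union> {s. b s \<noteq> 0})" "{s. a s \<noteq> 0} \<union> {s. b s \<noteq> 0} \<subseteq> T"
    using assms unfolding fin_coeffs_def by blast+
  ultimately show ?thesis
    unfolding fin_coeffs_def using finite_subset subset_trans by blast
qed

lemma kernel_comb_lincomb:
  assumes "a \<in> fin_coeffs T" "b \<in> fin_coeffs T"
  shows "kernel_comb K (\<lambda>s. \<alpha> * a s + \<beta> * b s) t = \<alpha> * kernel_comb K a t + \<beta> * kernel_comb K b t"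
proof -
  let ?S = "{s. a s \<noteq> 0} \<union> {s. b s \<noteq> 0}"
  have f: "finite ?S" using assms by (auto simp: fin_coeffs_def)
  have "kernel_comb K (\<lambda>s. \<alpha> * a s + \<beta> * b s) t = (\<Sum>s\<in>?S. (\<alpha> * a s + \<beta> * b s) * K s t)"
    by (rule kernel_comb_superset[OF f]) auto
  moreover have "kernel_comb K a t = (\<Sum>s\<in>?S. a s * K s t)"
    "kernel_comb K b t = (\<Sum>s\<in>?S. b s * K s t)"
    by (rule kernel_comb_superset[OF f]; auto)+
  ultimately show ?thesis
    by (simp add: sum_distrib_left flip: sum.distrib) (simp add: algebra_simps)
qed

lemma kernel_ip_lincomb_left:
  assumes "a \<in> fin_coeffs T" "b \<in> fin_coeffs T" "c \<in> fin_coeffs T"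
  shows "kernel_ip K (\<lambda>s. \<alpha> * a s + \<beta> * b s) c = \<alpha> * kernel_ip K a c + \<beta> * kernel_ip K b c"
proof -
  let ?S = "{s. a s \<noteq> 0} \<union> {s. b s \<noteq> 0} \<union> {s. c s \<noteq> 0}"
  have f: "finite ?S" using assms by (auto simp: fin_coeffs_def)
  have "kernel_ip K (\<lambda>s. \<alpha> * a s + \<beta> * b s) c =
      (\<Sum>s\<in>?S. \<Sum>t\<in>?S. (\<alpha> * a s + \<beta> * b s) * c t * K s t)"
    by (rule kernel_ip_superset[OF f]) auto
  moreover have "kernel_ip K a c = (\<Sum>s\<in>?S. \<Sum>t\<in>?S. a s * c t * K s t)"
    "kernel_ip K b c = (\<Sum>s\<in>?S. \<Sum>t\<in>?S. b s * c t * K s t)"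
    by (rule kernel_ip_superset[OF f]; auto)+
  ultimately show ?thesis
    by (simp add: sum_distrib_left flip: sum.distrib) (simp add: algebra_simps)
qed

lemma kernel_ip_commute:
  assumes "psd_kernel T K" "a \<in> fin_coeffs T" "b \<in> fin_coeffs T"
  shows "kernel_ip K a b = kernel_ip K b a"
proof -
  have "kernel_ip K a b = (\<Sum>t | b t \<noteq> 0. \<Sum>s | a s \<noteq> 0. a s * b t * K s t)"
    unfolding kernel_ip_def by (rule sum.swap)
  also have "\<dots> = kernel_ip K b a"
  proof -
    have "a s * b t * K s t = b t * a s * K t s" if "a s \<noteq> 0" "b t \<noteq> 0" for s t
    proof -
      have "s \<in> T" "t \<in> T" using assms that by (auto simp: fin_coeffs_def)
      then have e: "K s t = K t s" using assms(1) unfolding psd_kernel_def by blast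
      show ?thesis by (subst e) (simp only: mult.commute)
    qed
    then show ?thesis unfolding kernel_ip_def by (intro sum.cong refl) blast
  qed
  finally show ?thesis .
qed

lemma kernel_ip_lincomb_right:
  assumes "psd_kernel T K" "a \<in> fin_coeffs T" "b \<in> fin_coeffs T" "c \<in> fin_coeffs T"
  shows "kernel_ip K c (\<lambda>s. \<alpha> * a s + \<beta> * b s) = \<alpha> * kernel_ip K c a + \<beta> * kernel_ip K c b"
  using kernel_ip_commute[OF assms(1,4) fin_coeffs_lincomb[OF assms(2,3)], of \<alpha> \<beta>]
    kernel_ip_commute[OF assms(1,4,2)] kernel_ip_commute[OF assms(1,4,3)]
    kernel_ip_lincomb_left[OF assms(2-4), of K \<alpha> \<beta>]
  by presburger

lemma kernel_ip_comb:
  assumes "psd_kernel T K" "a \<in> fin_coeffs T" "b \<in> fin_coeffs T"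
  shows "kernel_ip K a b = (\<Sum>s | a s \<noteq> 0. a s * kernel_comb K b s)"
proof -
  have "a s * b t * K s t = a s * (b t * K t s)" if "a s \<noteq> 0" "b t \<noteq> 0" for s t
  proof -
    have "s \<in> T" "t \<in> T" using assms that by (auto simp: fin_coeffs_def)
    then have e: "K s t = K t s" using assms(1) unfolding psd_kernel_def by blast
    show ?thesis by (subst e) (rule mult.assoc)
  qed
  then show ?thesis
    unfolding kernel_ip_def kernel_comb_def sum_distrib_left by (intro sum.cong refl) blast
qed

lemma kernel_norm_ge_0: "psd_kernel T K \<Longrightarrow> a \<in> fin_coeffs T \<Longrightarrow> 0 \<le> kernel_norm K a"
  by (simp add: kernel_norm_def psd_kernel_def)

lemma kernel_norm_sq:
  "psd_kernel T K \<Longrightarrow> a \<in> fin_coeffs T \<Longrightarrow> (kernel_norm K a)\<^sup>2 = kernel_ip K a a"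
  by (simp add: kernel_norm_def psd_kernel_def)

lemma kernel_Cauchy_Schwarz:
  assumes K: "psd_kernel T K" and a: "a \<in> fin_coeffs T" and b: "b \<in> fin_coeffs T"
  shows "\<bar>kernel_ip K a b\<bar> \<le> kernel_norm K a * kernel_norm K b"
proof -
  define A B C where "A = kernel_ip K a a" and "B = kernel_ip K a b" and "C = kernel_ip K b b"
  have B': "kernel_ip K b a = B" using kernel_ip_commute[OF K b a] by (simp only: B_def)
  have q: "0 \<le> x\<^sup>2 * A + 2 * x * y * B + y\<^sup>2 * C" for x y
  proof -
    have c: "(\<lambda>s. x * a s + y * b s) \<in> fin_coeffs T" using a b by (rule fin_coeffs_lincomb)
    have "0 \<le> kernel_ip K (\<lambda>s. x * a s + y * b s) (\<lambda>s. x * a s + y * b s)"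
      using K c by (simp add: psd_kernel_def)
    also have "\<dots> = x\<^sup>2 * A + 2 * x * y * B + y\<^sup>2 * C"
      by (simp add: kernel_ip_lincomb_left[OF a b c] kernel_ip_lincomb_right[OF K a b a]
          kernel_ip_lincomb_right[OF K a b b] B' power2_eq_square algebra_simps
          flip: A_def B_def C_def)
    finally show ?thesis .
  qed
  have A0: "0 \<le> A" and C0: "0 \<le> C" using K a b by (auto simp: A_def C_def psd_kernel_def)
  have "B\<^sup>2 \<le> A * C"
  proof (cases "A = 0")
    case True
    have "B = 0"
    proof (rule ccontr)
      assume "B \<noteq> 0"
      with q[of "- (C + 1) / (2 * B)" 1] True show False by (simp add: field_simps)
    qed
    then show ?thesis using True by simp
  next
    case False
    with A0 have "A > 0" by simp
    have "0 \<le> A * (A * C - B\<^sup>2)"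
      using q[of "- B" A] by (simp add: power2_eq_square algebra_simps)
    with \<open>A > 0\<close> show ?thesis by (simp add: zero_le_mult_iff)
  qed
  then have "sqrt (B\<^sup>2) \<le> sqrt (A * C)" by (rule real_sqrt_le_mono)
  then show ?thesis by (simp add: A_def B_def C_def kernel_norm_def real_sqrt_mult)
qed

lemma kernel_norm_triangle:
  assumes K: "psd_kernel T K" and a: "a \<in> fin_coeffs T" and b: "b \<in> fin_coeffs T"
  shows "kernel_norm K (\<lambda>s. \<alpha> * a s + \<beta> * b s)
       \<le> \<bar>\<alpha>\<bar> * kernel_norm K a + \<bar>\<beta>\<bar> * kernel_norm K b"
proof (rule power2_le_imp_le)
  have c: "(\<lambda>s. \<alpha> * a s + \<beta> * b s) \<in> fin_coeffs T" using a b by (rule fin_coeffs_lincomb)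
  have "(kernel_norm K (\<lambda>s. \<alpha> * a s + \<beta> * b s))\<^sup>2
      = \<alpha>\<^sup>2 * (kernel_norm K a)\<^sup>2 + 2 * (\<alpha> * \<beta> * kernel_ip K a b) + \<beta>\<^sup>2 * (kernel_norm K b)\<^sup>2"
    unfolding kernel_norm_sq[OF K a] kernel_norm_sq[OF K b] kernel_norm_sq[OF K c]
      kernel_ip_lincomb_left[OF a b c] kernel_ip_lincomb_right[OF K a b a]
      kernel_ip_lincomb_right[OF K a b b] kernel_ip_commute[OF K b a]
    by (simp add: power2_eq_square algebra_simps)
  also have "\<alpha> * \<beta> * kernel_ip K a b \<le> \<bar>\<alpha> * \<beta>\<bar> * (kernel_norm K a * kernel_norm K b)"
  proof -
    have "\<alpha> * \<beta> * kernel_ip K a b \<le> \<bar>\<alpha> * \<beta>\<bar> * \<bar>kernel_ip K a b\<bar>"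
      using abs_ge_self[of "\<alpha> * \<beta> * kernel_ip K a b"] by (simp only: abs_mult)
    also have "\<dots> \<le> \<bar>\<alpha> * \<beta>\<bar> * (kernel_norm K a * kernel_norm K b)"
      using kernel_Cauchy_Schwarz[OF K a b] by (rule mult_left_mono) simp
    finally show ?thesis .
  qed
  finally show "(kernel_norm K (\<lambda>s. \<alpha> * a s + \<beta> * b s))\<^sup>2
       \<le> (\<bar>\<alpha>\<bar> * kernel_norm K a + \<bar>\<beta>\<bar> * kernel_norm K b)\<^sup>2"
    by (simp add: power2_sum power_mult_distrib abs_mult algebra_simps)
  show "0 \<le> \<bar>\<alpha>\<bar> * kernel_norm K a + \<bar>\<beta>\<bar> * kernel_norm K b"
    using kernel_norm_ge_0[OF K] a b by simp
qed

lemma kernel_norm_diff: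
  assumes K: "psd_kernel T K" and a: "a \<in> fin_coeffs T" and b: "b \<in> fin_coeffs T"
  shows "\<bar>kernel_norm K a - kernel_norm K b\<bar> \<le> kernel_norm K (\<lambda>s. a s - b s)"
proof -
  have d: "(\<lambda>s. a s - b s) \<in> fin_coeffs T" using fin_coeffs_lincomb[OF a b, of 1 "-1"] by simp
  have "kernel_norm K a \<le> kernel_norm K (\<lambda>s. a s - b s) + kernel_norm K b"
    using kernel_norm_triangle[OF K d b, of 1 1] by simp
  moreover have "kernel_norm K b \<le> kernel_norm K a + kernel_norm K (\<lambda>s. a s - b s)"
    using kernel_norm_triangle[OF K a d, of 1 "-1"] by simp
  ultimately show ?thesis by linarith
qed

lemma rkhs_approx_lincomb:
  assumes K: "psd_kernel T K" and a: "rkhs_approx T K a f" and b: "rkhs_approx T K b g"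
  shows "rkhs_approx T K (\<lambda>n s. \<alpha> * a n s + \<beta> * b n s) (\<lambda>t. \<alpha> * f t + \<beta> * g t)"
proof -
  have ca: "a n \<in> fin_coeffs T" and cb: "b n \<in> fin_coeffs T" for n
    using a b by (auto simp: rkhs_approx_def)
  have "\<exists>N. \<forall>m\<ge>N. \<forall>n\<ge>N.
     kernel_norm K (\<lambda>s. (\<alpha> * a m s + \<beta> * b m s) - (\<alpha> * a n s + \<beta> * b n s)) < e" if "e > 0" for e
  proof -
    define d where "d = e / (\<bar>\<alpha>\<bar> + \<bar>\<beta>\<bar> + 1)"
    have d: "d > 0" using that by (simp add: d_def add_nonneg_pos)
    obtain N1 where N1: "\<And>m n. m \<ge> N1 \<Longrightarrow> n \<ge> N1 \<Longrightarrow> kernel_norm K (\<lambda>s. a m s - a n s) < d"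
      using a d unfolding rkhs_approx_def by blast
    obtain N2 where N2: "\<And>m n. m \<ge> N2 \<Longrightarrow> n \<ge> N2 \<Longrightarrow> kernel_norm K (\<lambda>s. b m s - b n s) < d"
      using b d unfolding rkhs_approx_def by blast
    have "kernel_norm K (\<lambda>s. (\<alpha> * a m s + \<beta> * b m s) - (\<alpha> * a n s + \<beta> * b n s)) < e"
      if mn: "m \<ge> max N1 N2" "n \<ge> max N1 N2" for m n
    proof -
      have da: "(\<lambda>s. a m s - a n s) \<in> fin_coeffs T" using fin_coeffs_lincomb[OF ca ca, of 1 m "-1" n] by simp
      have db: "(\<lambda>s. b m s - b n s) \<in> fin_coeffs T" using fin_coeffs_lincomb[OF cb cb, of 1 m "-1" n] by simp
      have "(\<lambda>s. (\<alpha> * a m s + \<beta> * b m s) - (\<alpha> * a n s + \<beta> * b n s))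
          = (\<lambda>s. \<alpha> * (a m s - a n s) + \<beta> * (b m s - b n s))" by (auto simp: algebra_simps)
      then have "kernel_norm K (\<lambda>s. (\<alpha> * a m s + \<beta> * b m s) - (\<alpha> * a n s + \<beta> * b n s))
          \<le> \<bar>\<alpha>\<bar> * kernel_norm K (\<lambda>s. a m s - a n s) + \<bar>\<beta>\<bar> * kernel_norm K (\<lambda>s. b m s - b n s)"
        using kernel_norm_triangle[OF K da db] by simp
      also have "\<dots> \<le> \<bar>\<alpha>\<bar> * d + \<bar>\<beta>\<bar> * d"
        using N1[of m n] N2[of m n] mn by (intro add_mono mult_left_mono) auto
      also have "\<dots> < (\<bar>\<alpha>\<bar> + \<bar>\<beta>\<bar> + 1) * d" using d by (simp add: algebra_simps)
      also have "\<dots> = e" by (simp add: d_def add_nonneg_eq_0_iff)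
      finally show ?thesis .
    qed
    then show ?thesis by blast
  qed
  moreover have "(\<lambda>n. kernel_comb K (\<lambda>s. \<alpha> * a n s + \<beta> * b n s) t) \<longlonglongrightarrow> \<alpha> * f t + \<beta> * g t"
    if "t \<in> T" for t
    unfolding kernel_comb_lincomb[OF ca cb]
    using a b that by (intro tendsto_intros) (auto simp: rkhs_approx_def)
  ultimately show ?thesis
    using a b fin_coeffs_lincomb[OF ca cb] by (simp add: rkhs_approx_def)
qed

lemma rkhs_lincomb:
  assumes "psd_kernel T K" "f \<in> rkhs T K" "g \<in> rkhs T K"
  shows "(\<lambda>t. \<alpha> * f t + \<beta> * g t) \<in> rkhs T K"
  using assms rkhs_approx_lincomb unfolding rkhs_def by blast

lemma rkhs_approx_norm_convergent:
  assumes K: "psd_kernel T K" and a: "rkhs_approx T K a f"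
  shows "convergent (\<lambda>n. kernel_norm K (a n))"
proof -
  have ca: "a n \<in> fin_coeffs T" for n using a by (auto simp: rkhs_approx_def)
  have "Cauchy (\<lambda>n. kernel_norm K (a n))"
  proof (rule metric_CauchyI)
    fix e :: real assume "e > 0"
    then obtain N where N: "\<And>m n. m \<ge> N \<Longrightarrow> n \<ge> N \<Longrightarrow> kernel_norm K (\<lambda>s. a m s - a n s) < e"
      using a unfolding rkhs_approx_def by blast
    have "dist (kernel_norm K (a m)) (kernel_norm K (a n)) < e" if "m \<ge> N" "n \<ge> N" for m n
      using kernel_norm_diff[OF K ca ca, of m n] N[OF that] by (simp add: dist_real_def)
    then show "\<exists>M. \<forall>m\<ge>M. \<forall>n\<ge>M. dist (kernel_norm K (a m)) (kernel_norm K (a n)) < e" by blast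
  qed
  then show ?thesis by (rule Cauchy_convergent)
qed

lemma rkhs_approx_zero:
  assumes K: "psd_kernel T K" and a: "rkhs_approx T K a (\<lambda>t. 0)"
  shows "(\<lambda>n. kernel_norm K (a n)) \<longlonglongrightarrow> 0"
proof -
  have ca: "a n \<in> fin_coeffs T" for n using a by (auto simp: rkhs_approx_def)
  obtain r where r: "(\<lambda>n. kernel_norm K (a n)) \<longlonglongrightarrow> r"
    using rkhs_approx_norm_convergent[OF K a] by (auto simp: convergent_def)
  have weak: "(\<lambda>m. kernel_ip K (a n) (a m)) \<longlonglongrightarrow> 0" for n
  proof -
    have "(\<lambda>m. \<Sum>s | a n s \<noteq> 0. a n s * kernel_comb K (a m) s) \<longlonglongrightarrow> (\<Sum>s | a n s \<noteq> 0. a n s * 0)"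
    proof (intro tendsto_intros)
      fix s assume "s \<in> {s. a n s \<noteq> 0}"
      then have "s \<in> T" using ca[of n] by (auto simp: fin_coeffs_def)
      then show "(\<lambda>m. kernel_comb K (a m) s) \<longlonglongrightarrow> 0" using a by (simp add: rkhs_approx_def)
    qed
    then show ?thesis by (simp add: kernel_ip_comb[OF K ca ca])
  qed
  have "r\<^sup>2 \<le> r * e" if e: "e > 0" for e
  proof -
    obtain N where N: "\<And>m n. m \<ge> N \<Longrightarrow> n \<ge> N \<Longrightarrow> kernel_norm K (\<lambda>s. a m s - a n s) < e"
      using a e unfolding rkhs_approx_def by blast
    have "(kernel_norm K (a n))\<^sup>2 \<le> kernel_norm K (a n) * e" if n: "n \<ge> N" for n
    proof -
      have "(kernel_norm K (a n))\<^sup>2 - kernel_ip K (a n) (a m) \<le> kernel_norm K (a n) * e"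
        if m: "m \<ge> N" for m
      proof -
        have d: "(\<lambda>s. a n s - a m s) \<in> fin_coeffs T"
          using fin_coeffs_lincomb[OF ca ca, of 1 n "-1" m] by simp
        have "(kernel_norm K (a n))\<^sup>2 - kernel_ip K (a n) (a m)
            = kernel_ip K (a n) (\<lambda>s. a n s - a m s)"
          using kernel_ip_lincomb_right[OF K ca ca ca, of n 1 n "-1" m]
          by (simp add: kernel_norm_sq[OF K ca])
        also have "\<dots> \<le> kernel_norm K (a n) * kernel_norm K (\<lambda>s. a n s - a m s)"
          using kernel_Cauchy_Schwarz[OF K ca d, of n] by linarith
        also have "\<dots> \<le> kernel_norm K (a n) * e"
          using N[OF n m] kernel_norm_ge_0[OF K ca] by (intro mult_left_mono) auto
        finally show ?thesis .
      qed
      moreover have "(\<lambda>m. (kernel_norm K (a n))\<^sup>2 - kernel_ip K (a n) (a m))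
          \<longlonglongrightarrow> (kernel_norm K (a n))\<^sup>2 - 0"
        by (intro tendsto_intros weak)
      ultimately show ?thesis
        by (metis (no_types, lifting) LIMSEQ_le_const2 diff_zero)
    qed
    then show ?thesis
      by (intro LIMSEQ_le[of "\<lambda>n. (kernel_norm K (a n))\<^sup>2" _ "\<lambda>n. kernel_norm K (a n) * e"]
          tendsto_intros r) auto
  qed
  then have sq: "r\<^sup>2 \<le> r * e" if "e > 0" for e using that by blast
  have "0 \<le> r" using r kernel_norm_ge_0[OF K ca] by (intro LIMSEQ_le_const[OF r]) auto
  have "r = 0"
  proof (rule ccontr)
    assume "r \<noteq> 0"
    with \<open>0 \<le> r\<close> have "r > 0" by simp
    with sq[of "r / 2"] show False by (simp add: power2_eq_square)
  qed
  with r show ?thesis by simp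
qed

lemma rkhs_norm_limit:
  assumes K: "psd_kernel T K" and a: "rkhs_approx T K a f"
  shows "(\<lambda>n. kernel_norm K (a n)) \<longlonglongrightarrow> rkhs_norm T K f"
proof -
  obtain r where r: "(\<lambda>n. kernel_norm K (a n)) \<longlonglongrightarrow> r"
    using rkhs_approx_norm_convergent[OF K a] by (auto simp: convergent_def)
  have "r' = r" if b: "rkhs_approx T K b f" and r': "(\<lambda>n. kernel_norm K (b n)) \<longlonglongrightarrow> r'" for b r'
  proof -
    have ca: "a n \<in> fin_coeffs T" and cb: "b n \<in> fin_coeffs T" for n
      using a b by (auto simp: rkhs_approx_def)
    have "rkhs_approx T K (\<lambda>n s. b n s - a n s) (\<lambda>t. 0)"
      using rkhs_approx_lincomb[OF K b a, of 1 "-1"] by simp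
    then have z: "(\<lambda>n. kernel_norm K (\<lambda>s. b n s - a n s)) \<longlonglongrightarrow> 0"
      by (rule rkhs_approx_zero[OF K])
    have "(\<lambda>n. kernel_norm K (b n) - kernel_norm K (a n)) \<longlonglongrightarrow> 0"
      using kernel_norm_diff[OF K cb ca]
      by (intro Lim_null_comparison[OF _ z]) (auto simp: eventually_sequentially)
    moreover have "(\<lambda>n. kernel_norm K (b n) - kernel_norm K (a n)) \<longlonglongrightarrow> r' - r"
      by (intro tendsto_intros r r')
    ultimately show ?thesis using LIMSEQ_unique by fastforce
  qed
  then have "rkhs_norm T K f = r"
    unfolding rkhs_norm_def using a r by (intro the_equality) blast+
  with r show ?thesis by simp
qed

lemma kernel_comb_rkhs:
  assumes K: "psd_kernel T K" and c: "c \<in> fin_coeffs T"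
  defines "f \<equiv> (\<lambda>t. if t \<in> T then kernel_comb K c t else 0)"
  shows "f \<in> rkhs T K" and "rkhs_norm T K f = kernel_norm K c"
proof -
  have a: "rkhs_approx T K (\<lambda>n. c) f"
    using c by (auto simp: rkhs_approx_def f_def kernel_norm_def kernel_ip_def)
  then show "f \<in> rkhs T K" by (auto simp: rkhs_def)
  show "rkhs_norm T K f = kernel_norm K c"
    using rkhs_norm_limit[OF K a] by (simp add: LIMSEQ_const_iff)
qed

lemma gaussian_rv_square_integrable:
  assumes M: "prob_space M" and X: "gaussian_rv M X"
  shows "integrable M X" "integrable M (\<lambda>\<omega>. (X \<omega>)\<^sup>2)"
proof -
  interpret prob_space M by (rule M)
  have m[measurable]: "X \<in> borel_measurable M" using X by (simp add: gaussian_rv_def)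
  have sq: "integrable M (\<lambda>\<omega>. (X \<omega>)\<^sup>2)"
  proof -
    consider \<mu> where "distr M borel X = return borel \<mu>"
      | \<mu> \<sigma> where "\<sigma> > 0" "distributed M lborel X (\<lambda>x. ennreal (normal_density \<mu> \<sigma> x))"
      using X by (auto simp: gaussian_rv_def)
    then show ?thesis
    proof cases
      case 1
      have "AE x in distr M borel X. x = \<mu>" unfolding 1 by (subst AE_return) auto
      then have ae: "AE \<omega> in M. X \<omega> = \<mu>" by (subst (asm) AE_distr_iff) auto
      have "integrable M (\<lambda>\<omega>. (X \<omega>)\<^sup>2) \<longleftrightarrow> integrable M (\<lambda>\<omega>. \<mu>\<^sup>2)"
        using ae by (intro integrable_cong_AE) auto
      then show ?thesis by simp
    next
      case 2
      have "integrable lborel (\<lambda>x. normal_density \<mu> \<sigma> x * (x - \<mu>)^2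
          + 2 * \<mu> * (normal_density \<mu> \<sigma> x * x) - \<mu>\<^sup>2 * normal_density \<mu> \<sigma> x)"
        using 2(1) by (intro Bochner_Integration.integrable_add Bochner_Integration.integrable_diff
            integrable_mult_right integrable_normal_moment integrable_normal_moment_nz_1
            integrable_normal_density)
      also have "(\<lambda>x. normal_density \<mu> \<sigma> x * (x - \<mu>)^2
          + 2 * \<mu> * (normal_density \<mu> \<sigma> x * x) - \<mu>\<^sup>2 * normal_density \<mu> \<sigma> x)
          = (\<lambda>x. normal_density \<mu> \<sigma> x * x\<^sup>2)"
        by (auto simp: fun_eq_iff power2_eq_square algebra_simps)
      finally show ?thesis
        using distributed_integrable[OF 2(2), of "\<lambda>x. x\<^sup>2"] by simp
    qed
  qed
  then show "integrable M (\<lambda>\<omega>. (X \<omega>)\<^sup>2)" .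
  show "integrable M X" using square_integrable_imp_integrable[OF m sq] .
qed

lemma gaussian_process_rv:
  assumes "gaussian_process M T W" "t \<in> T"
  shows "gaussian_rv M (W t)"
proof -
  have "gaussian_rv M (\<lambda>\<omega>. \<Sum>s\<in>{t}. 1 * W s \<omega>)"
    using assms unfolding gaussian_process_def
    by (elim conjE allE[where x = "{t}"] allE[where x = "\<lambda>_. 1"]) auto
  then show ?thesis by simp
qed

lemma covariance_kernel_psd:
  assumes W: "gaussian_process M T W" and K: "has_covariance_kernel M T W K"
  shows "psd_kernel T K"
proof -
  interpret prob_space M using W by (simp add: gaussian_process_def)
  define Z where "Z t \<omega> = W t \<omega> - (\<integral>\<omega>'. W t \<omega>' \<partial>M)" for t \<omega>
  have Km: "K s t = (\<integral>\<omega>. Z s \<omega> * Z t \<omega> \<partial>M)" if "s \<in> T" "t \<in> T" for s t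
    using K that by (simp add: has_covariance_kernel_def covariance_def Z_def)
  have int: "integrable M (\<lambda>\<omega>. Z s \<omega> * Z t \<omega>)" if st: "s \<in> T" "t \<in> T" for s t
  proof -
    have g: "gaussian_rv M (W s)" "gaussian_rv M (W t)" by (rule gaussian_process_rv[OF W], rule st)+
    have i: "integrable M (W s)" "integrable M (W t)"
        "integrable M (\<lambda>\<omega>. (W s \<omega>)\<^sup>2)" "integrable M (\<lambda>\<omega>. (W t \<omega>)\<^sup>2)"
      using gaussian_rv_square_integrable[OF prob_space_axioms] g by auto
    have [measurable]: "W s \<in> borel_measurable M" "W t \<in> borel_measurable M"
      using g by (auto simp: gaussian_rv_def)
    have "integrable M (\<lambda>\<omega>. W s \<omega> * W t \<omega>)"
    proof (rule Bochner_Integration.integrable_bound)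
      show "integrable M (\<lambda>\<omega>. (W s \<omega>)\<^sup>2 + (W t \<omega>)\<^sup>2)" using i by simp
      have "\<bar>x * y\<bar> \<le> x\<^sup>2 + y\<^sup>2" for x y :: real
      proof -
        have "2 * (\<bar>x\<bar> * \<bar>y\<bar>) \<le> x\<^sup>2 + y\<^sup>2"
          using sum_squares_bound[of "\<bar>x\<bar>" "\<bar>y\<bar>"] by simp
        moreover have "0 \<le> \<bar>x\<bar> * \<bar>y\<bar>" by simp
        ultimately show ?thesis unfolding abs_mult by linarith
      qed
      then show "AE \<omega> in M. norm (W s \<omega> * W t \<omega>) \<le> norm ((W s \<omega>)\<^sup>2 + (W t \<omega>)\<^sup>2)"
        by (auto simp: abs_mult)
    qed auto
    then show ?thesis using i by (simp add: Z_def left_diff_distrib right_diff_distrib)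
  qed
  have "0 \<le> kernel_ip K a a" if a: "a \<in> fin_coeffs T" for a
  proof -
    let ?S = "{s. a s \<noteq> 0}"
    have S: "finite ?S" "?S \<subseteq> T" using a by (auto simp: fin_coeffs_def)
    have "kernel_ip K a a = (\<Sum>s\<in>?S. \<Sum>t\<in>?S. a s * a t * (\<integral>\<omega>. Z s \<omega> * Z t \<omega> \<partial>M))"
      unfolding kernel_ip_def using S(2) by (intro sum.cong refl) (auto simp: Km subset_iff)
    also have "\<dots> = (\<Sum>s\<in>?S. \<Sum>t\<in>?S. (\<integral>\<omega>. a s * a t * (Z s \<omega> * Z t \<omega>) \<partial>M))"
      by simp
    also have "\<dots> = (\<integral>\<omega>. (\<Sum>s\<in>?S. \<Sum>t\<in>?S. a s * a t * (Z s \<omega> * Z t \<omega>)) \<partial>M)"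
      using S int by (subst Bochner_Integration.integral_sum,
          force intro!: Bochner_Integration.integrable_sum integrable_mult_right,
          intro sum.cong refl, subst Bochner_Integration.integral_sum,
          force intro!: integrable_mult_right, simp)
    also have "\<dots> = (\<integral>\<omega>. (\<Sum>s\<in>?S. a s * Z s \<omega>)\<^sup>2 \<partial>M)"
      by (simp add: power2_eq_square sum_product algebra_simps)
    also have "\<dots> \<ge> 0" by (rule integral_nonneg_AE) simp
    finally show ?thesis .
  qed
  moreover have "K s t = K t s" if "s \<in> T" "t \<in> T" for s t
    unfolding Km[OF that] Km[OF that(2) that(1)] by (simp only: mult.commute)
  ultimately show ?thesis unfolding psd_kernel_def by blast
qed

text \<open>Reindexing a Gaussian process by \<open>Q\<close> gives a Gaussian process with the pulled-back kernel,
  so the pulled-back kernel is again a covariance kernel.\<close>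

lemma gaussian_process_reindex:
  assumes W: "gaussian_process M T W" and Q: "Q ` S \<subseteq> T"
  shows "gaussian_process M S (\<lambda>s. W (Q s))"
proof -
  have "gaussian_rv M (\<lambda>\<omega>. \<Sum>s\<in>F. c s * W (Q s) \<omega>)" if F: "finite F" "F \<subseteq> S" for F c
  proof -
    have "(\<Sum>s\<in>F. c s * W (Q s) \<omega>) = (\<Sum>t\<in>Q ` F. (\<Sum>s | s \<in> F \<and> Q s = t. c s) * W t \<omega>)" for \<omega>
    proof -
      have "(\<Sum>s\<in>F. c s * W (Q s) \<omega>)
          = (\<Sum>t\<in>Q ` F. \<Sum>s | s \<in> F \<and> Q s = t. c s * W (Q s) \<omega>)"
        by (rule sum.image_gen[OF F(1)])
      then show ?thesis by (simp add: sum_distrib_right)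
    qed
    moreover have "finite (Q ` F)" "Q ` F \<subseteq> T" using F Q by auto
    ultimately show ?thesis using W by (simp add: gaussian_process_def)
  qed
  then show ?thesis using W by (simp add: gaussian_process_def)
qed

lemma has_covariance_kernel_reindex:
  assumes "has_covariance_kernel M T W K" "Q ` S \<subseteq> T"
    and "\<And>s t. s \<in> S \<Longrightarrow> t \<in> S \<Longrightarrow> G s t = K (Q s) (Q t)"
  shows "has_covariance_kernel M S (\<lambda>s. W (Q s)) G"
  using assms by (auto simp: has_covariance_kernel_def image_subset_iff)

end

theory Submission
  imports Defs
begin

text \<open>The isometry is composition with \<open>Q\<close>, \<open>f \<mapsto> f \<circ> Q\<close>, from functions on the sphere to
  functions on the cube; its inverse is composition with a right inverse \<open>r\<close> of \<open>Q\<close>. Since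
  \<open>G s x = K (Q s) (Q x)\<close>, a combination \<open>\<Sum>s. a s * G s \<cdot>\<close> is the composite with \<open>Q\<close> of
  \<open>\<Sum>s. a s * K (Q s) \<cdot>\<close>, and both have the same norm: each inner product is
  \<open>\<Sum>s x. a s * a x * K (Q s) (Q x)\<close>. In terms of coefficients this is the push-forward of finitely
  supported functions along \<open>Q\<close>, which may merge points, and the push-forward along \<open>r\<close> goes back.
  Both preserve the kernel inner product, so they carry Cauchy sequences of
  combinations to Cauchy sequences, and pointwise limits follow by composition
  (\<open>rkhs_approx_push\<close>, used once for \<open>Q\<close> and once for \<open>r\<close>).

  That \<open>K\<close> is a covariance kernel enters through positive semidefiniteness, which makes the
  RKHS norm the limit of the norms along any approximating sequence.

  Two points need surjectivity of \<open>Q\<close>. A function on the sphere is determined by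
  its composite with \<open>Q\<close>, and it has the same values as the composite, hence the same
  supremum norm. Moreover, every \<open>g\<close> in the RKHS of \<open>G\<close> is such a composite, because all
  \<open>G s \<cdot>\<close> take equal values at points with the same image under \<open>Q\<close>, and this survives
  pointwise limits (\<open>rkhs_equal_values\<close>).\<close>

definition push_coeffs :: "('i \<Rightarrow> 'j) \<Rightarrow> ('i \<Rightarrow> real) \<Rightarrow> 'j \<Rightarrow> real" where
  "push_coeffs p a y = (\<Sum>x | a x \<noteq> 0 \<and> p x = y. a x)"

text \<open>The cut-off to \<open>0\<close> outside \<open>S\<close> is there because elements of an RKHS on \<open>S\<close> are represented
  by functions on the whole type that vanish outside \<open>S\<close>.\<close>

definition pull_fun :: "'i set \<Rightarrow> ('i \<Rightarrow> 'j) \<Rightarrow> ('j \<Rightarrow> real) \<Rightarrow> 'i \<Rightarrow> real" where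
  "pull_fun S q f x = (if x \<in> S then f (q x) else 0)"

lemma push_coeffs_support: "{y. push_coeffs p a y \<noteq> 0} \<subseteq> p ` {x. a x \<noteq> 0}"
proof
  fix y assume "y \<in> {y. push_coeffs p a y \<noteq> 0}"
  then have "{x. a x \<noteq> 0 \<and> p x = y} \<noteq> {}"
    unfolding push_coeffs_def mem_Collect_eq by (metis sum.empty)
  then show "y \<in> p ` {x. a x \<noteq> 0}" by auto
qed

lemma push_coeffs_fin_coeffs:
  assumes "a \<in> fin_coeffs T" "p \<in> T \<rightarrow> S"
  shows "push_coeffs p a \<in> fin_coeffs S"
proof -
  have "p ` {x. a x \<noteq> 0} \<subseteq> S" "finite (p ` {x. a x \<noteq> 0})"
    using assms by (auto simp: fin_coeffs_def)
  then show ?thesis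
    using push_coeffs_support[of p a] unfolding fin_coeffs_def
    by (auto intro: finite_subset)
qed

text \<open>Change of variables: a coefficient function acts as a signed measure of finite support,
  and \<open>push_coeffs\<close> is its image measure.\<close>

lemma sum_push_coeffs:
  assumes "finite {x. a x \<noteq> 0}"
  shows "(\<Sum>y | push_coeffs p a y \<noteq> 0. push_coeffs p a y * h y)
       = (\<Sum>x | a x \<noteq> 0. a x * h (p x))"
proof -
  have "(\<Sum>y | push_coeffs p a y \<noteq> 0. push_coeffs p a y * h y)
      = (\<Sum>y\<in>p ` {x. a x \<noteq> 0}. push_coeffs p a y * h y)"
    using assms push_coeffs_support[of p a] by (intro sum.mono_neutral_left) auto
  also have "\<dots> = (\<Sum>y\<in>p ` {x. a x \<noteq> 0}. \<Sum>x | x \<in> {x. a x \<noteq> 0} \<and> p x = y. a x * h (p x))"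
    by (intro sum.cong refl) (simp add: push_coeffs_def sum_distrib_right)
  also have "\<dots> = (\<Sum>x | a x \<noteq> 0. a x * h (p x))"
    by (rule sum.image_gen[OF assms, symmetric])
  finally show ?thesis .
qed

lemma push_coeffs_diff:
  assumes "finite {x. a x \<noteq> 0}" "finite {x. b x \<noteq> 0}"
  shows "push_coeffs p (\<lambda>x. a x - b x) = (\<lambda>y. push_coeffs p a y - push_coeffs p b y)"
proof
  fix y
  let ?S = "{x. (a x \<noteq> 0 \<or> b x \<noteq> 0) \<and> p x = y}"
  have f: "finite ?S"
    by (rule finite_subset[of _ "{x. a x \<noteq> 0} \<union> {x. b x \<noteq> 0}"]) (use assms in auto)
  have "push_coeffs p (\<lambda>x. a x - b x) y = (\<Sum>x\<in>?S. a x - b x)"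
    "push_coeffs p a y = (\<Sum>x\<in>?S. a x)" "push_coeffs p b y = (\<Sum>x\<in>?S. b x)"
    unfolding push_coeffs_def by (rule sum.mono_neutral_left[OF f]; auto)+
  then show "push_coeffs p (\<lambda>x. a x - b x) y = push_coeffs p a y - push_coeffs p b y"
    by (simp add: sum_subtractf)
qed

lemma kernel_comb_push:
  assumes a: "a \<in> fin_coeffs T" and G: "\<And>t. t \<in> T \<Longrightarrow> G (p t) s = K t t'"
  shows "kernel_comb G (push_coeffs p a) s = kernel_comb K a t'"
proof -
  have "kernel_comb G (push_coeffs p a) s = (\<Sum>t | a t \<noteq> 0. a t * G (p t) s)"
    unfolding kernel_comb_def using a by (intro sum_push_coeffs) (simp add: fin_coeffs_def)
  then show ?thesis
    unfolding kernel_comb_def using a G by (auto simp: fin_coeffs_def intro!: sum.cong)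
qed

lemma kernel_ip_push:
  assumes a: "a \<in> fin_coeffs T" and b: "b \<in> fin_coeffs T"
    and G: "\<And>s t. s \<in> T \<Longrightarrow> t \<in> T \<Longrightarrow> G (p s) (p t) = K s t"
  shows "kernel_ip G (push_coeffs p a) (push_coeffs p b) = kernel_ip K a b"
proof -
  have fa: "finite {s. a s \<noteq> 0}" and fb: "finite {s. b s \<noteq> 0}"
    using a b by (auto simp: fin_coeffs_def)
  have ip: "kernel_ip H c d = (\<Sum>s | c s \<noteq> 0. c s * (\<Sum>t | d t \<noteq> 0. d t * H s t))"
    for c d :: "'z \<Rightarrow> real" and H
    unfolding kernel_ip_def by (simp add: sum_distrib_left mult.assoc)
  have "kernel_ip G (push_coeffs p a) (push_coeffs p b)
      = (\<Sum>s | a s \<noteq> 0. a s * (\<Sum>t | b t \<noteq> 0. b t * G (p s) (p t)))"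
    by (simp only: ip sum_push_coeffs[OF fa] sum_push_coeffs[OF fb])
  also have "\<dots> = kernel_ip K a b"
    unfolding ip using a b G
    by (intro sum.cong refl arg_cong2[where f = "(*)"]) (auto simp: fin_coeffs_def)
  finally show ?thesis .
qed

lemma kernel_norm_push:
  assumes "a \<in> fin_coeffs T" "\<And>s t. s \<in> T \<Longrightarrow> t \<in> T \<Longrightarrow> G (p s) (p t) = K s t"
  shows "kernel_norm G (push_coeffs p a) = kernel_norm K a"
  unfolding kernel_norm_def using assms by (subst kernel_ip_push[where T = T and K = K]) auto

lemma psd_kernel_pullback:
  assumes K: "psd_kernel T K" and q: "q \<in> S \<rightarrow> T"
    and G: "\<And>s t. s \<in> S \<Longrightarrow> t \<in> S \<Longrightarrow> G s t = K (q s) (q t)"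
  shows "psd_kernel S G"
proof -
  have "0 \<le> kernel_ip G a a" if a: "a \<in> fin_coeffs S" for a
    using K push_coeffs_fin_coeffs[OF a q] kernel_ip_push[OF a a, of K q G] G
    by (auto simp: psd_kernel_def)
  moreover have "G s t = G t s" if "s \<in> S" "t \<in> S" for s t
    using K q that unfolding psd_kernel_def G[OF that] G[OF that(2) that(1)] by blast
  ultimately show ?thesis unfolding psd_kernel_def by blast
qed

text \<open>The condition \<open>adj\<close> says that pushing coefficients along \<open>p\<close> corresponds to composing
  functions with \<open>q\<close>, and \<open>iso\<close> that pushing preserves the inner product. In this form the lemma covers both a surjection
  \<open>q\<close> with a right inverse \<open>p\<close> and the same pair in the opposite roles.\<close>

lemma rkhs_approx_push:
  assumes p: "p \<in> T \<rightarrow> S" and q: "q \<in> S \<rightarrow> T"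
    and adj: "\<And>t s. t \<in> T \<Longrightarrow> s \<in> S \<Longrightarrow> G (p t) s = K t (q s)"
    and iso: "\<And>s t. s \<in> T \<Longrightarrow> t \<in> T \<Longrightarrow> G (p s) (p t) = K s t"
    and a: "rkhs_approx T K a f"
  shows "rkhs_approx S G (\<lambda>n. push_coeffs p (a n)) (pull_fun S q f)"
proof -
  have ca: "a n \<in> fin_coeffs T" for n using a by (simp add: rkhs_approx_def)
  have norm: "kernel_norm G (\<lambda>s. push_coeffs p (a m) s - push_coeffs p (a n) s)
      = kernel_norm K (\<lambda>s. a m s - a n s)" for m n
  proof -
    have d: "(\<lambda>s. a m s - a n s) \<in> fin_coeffs T"
      using fin_coeffs_lincomb[OF ca ca, of 1 m "-1" n] by simp
    have "finite {s. a k s \<noteq> 0}" for k using ca[of k] by (simp add: fin_coeffs_def)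
    then show ?thesis
      using kernel_norm_push[OF d, of G p K] iso by (simp add: push_coeffs_diff)
  qed
  have "(\<lambda>n. kernel_comb G (push_coeffs p (a n)) s) \<longlonglongrightarrow> pull_fun S q f s" if s: "s \<in> S" for s
  proof -
    have "kernel_comb G (push_coeffs p (a n)) s = kernel_comb K (a n) (q s)" for n
      using ca adj s by (intro kernel_comb_push) auto
    moreover have "q s \<in> T" using q s by auto
    ultimately show ?thesis using a s by (simp add: rkhs_approx_def pull_fun_def)
  qed
  then show ?thesis
    using a push_coeffs_fin_coeffs[OF ca p]
    unfolding rkhs_approx_def norm by (simp add: pull_fun_def)
qed

text \<open>Elements of an RKHS inherit the coincidences of the kernel, as pointwise limits of
  combinations of the functions \<open>K t \<cdot>\<close>.\<close>

lemma rkhs_equal_values: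
  assumes f: "f \<in> rkhs T K" and xy: "x \<in> T" "y \<in> T"
    and eq: "\<And>t. t \<in> T \<Longrightarrow> K t x = K t y"
  shows "f x = f y"
proof -
  obtain a where a: "rkhs_approx T K a f" using f by (auto simp: rkhs_def)
  then have ca: "a n \<in> fin_coeffs T" for n by (simp add: rkhs_approx_def)
  have "kernel_comb K (a n) x = kernel_comb K (a n) y" for n
    unfolding kernel_comb_def using ca[of n] eq by (auto simp: fin_coeffs_def intro!: sum.cong)
  moreover have "(\<lambda>n. kernel_comb K (a n) x) \<longlonglongrightarrow> f x" "(\<lambda>n. kernel_comb K (a n) y) \<longlonglongrightarrow> f y"
    using a xy by (auto simp: rkhs_approx_def)
  ultimately show ?thesis using LIMSEQ_unique by simp
qed

text \<open>The spaces are related in the direction from \<open>S\<close> to \<open>T\<close>, so the isometry is composition with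
  the right inverse \<open>r\<close> of \<open>Q\<close>; on the RKHS of \<open>G\<close> it does not depend on the choice of \<open>r\<close>. One and
  the same map serves for both norms.\<close>

theorem rkhs_reindex_isometric:
  assumes K: "psd_kernel T K" and Q: "Q ` S = T"
    and G: "\<And>s t. s \<in> S \<Longrightarrow> t \<in> S \<Longrightarrow> G s t = K (Q s) (Q t)"
  shows "isometric (rkhs S G) (rkhs_norm S G) (rkhs T K) (rkhs_norm T K)"
    and "isometric (rkhs S G) (sup_norm S) (rkhs T K) (sup_norm T)"
proof -
  define r where "r = inv_into S Q"
  have Qf: "Q \<in> S \<rightarrow> T" using Q by auto
  have rf: "r \<in> T \<rightarrow> S" unfolding r_def using Q by (auto intro: inv_into_into)
  have Qr: "Q (r t) = t" if "t \<in> T" for t unfolding r_def using Q that by (simp add: f_inv_into_f)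
  have psdG: "psd_kernel S G" using psd_kernel_pullback[OF K Qf G] .
  have rS: "r t \<in> S" if "t \<in> T" for t using rf that by auto
  have QT: "Q s \<in> T" if "s \<in> S" for s using Qf that by auto
  have push_Q: "rkhs_approx T K (\<lambda>n. push_coeffs Q (a n)) (pull_fun T r g)"
    if "rkhs_approx S G a g" for a g
    by (rule rkhs_approx_push[OF Qf rf _ _ that]) (simp_all add: G rS Qr)
  have push_r: "rkhs_approx S G (\<lambda>n. push_coeffs r (b n)) (pull_fun S Q f)"
    if "rkhs_approx T K b f" for b f
    by (rule rkhs_approx_push[OF rf Qf _ _ that]) (simp_all add: G rS Qr)
  have r_Q_value: "g (r (Q s)) = g s" if "g \<in> rkhs S G" "s \<in> S" for g s
    by (rule rkhs_equal_values[OF that(1)]) (simp_all add: that(2) G rS QT Qr)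
  have outside: "h x = 0" if "h \<in> rkhs U H" "x \<notin> U" for h x U and H :: "'z \<Rightarrow> 'z \<Rightarrow> real"
    using that by (auto simp: rkhs_def rkhs_approx_def)
  have bij: "bij_betw (pull_fun T r) (rkhs S G) (rkhs T K)"
  proof (rule bij_betw_byWitness[where f' = "pull_fun S Q"])
    show "\<forall>g\<in>rkhs S G. pull_fun S Q (pull_fun T r g) = g"
      by (auto simp: fun_eq_iff pull_fun_def r_Q_value QT outside)
    show "\<forall>f\<in>rkhs T K. pull_fun T r (pull_fun S Q f) = f"
      by (auto simp: fun_eq_iff pull_fun_def Qr rS outside)
    show "pull_fun T r ` rkhs S G \<subseteq> rkhs T K" using push_Q by (auto simp: rkhs_def)
    show "pull_fun S Q ` rkhs T K \<subseteq> rkhs S G" using push_r by (auto simp: rkhs_def)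
  qed
  have lin: "pull_fun T r (\<lambda>x. \<alpha> * f x + \<beta> * g x)
      = (\<lambda>y. \<alpha> * pull_fun T r f y + \<beta> * pull_fun T r g y)" for f g \<alpha> \<beta>
    by (auto simp: fun_eq_iff pull_fun_def)
  have "rkhs_norm T K (pull_fun T r g) = rkhs_norm S G g" if g: "g \<in> rkhs S G" for g
  proof -
    obtain a where a: "rkhs_approx S G a g" using g by (auto simp: rkhs_def)
    then have ca: "a n \<in> fin_coeffs S" for n by (simp add: rkhs_approx_def)
    have "kernel_norm K (push_coeffs Q (a n)) = kernel_norm G (a n)" for n
      by (rule kernel_norm_push[OF ca]) (simp add: G)
    then show ?thesis
      using rkhs_norm_limit[OF psdG a] rkhs_norm_limit[OF K push_Q[OF a]] LIMSEQ_unique by simp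
  qed
  with bij lin show "isometric (rkhs S G) (rkhs_norm S G) (rkhs T K) (rkhs_norm T K)"
    unfolding isometric_def by (intro exI[of _ "pull_fun T r"]) simp
  have "sup_norm T (pull_fun T r g) = sup_norm S g" if g: "g \<in> rkhs S G" for g
  proof -
    have "sup_norm T (pull_fun T r g) = (SUP s\<in>S. ennreal \<bar>pull_fun T r g (Q s)\<bar>)"
      unfolding sup_norm_def Q[symmetric] by (simp add: image_image)
    also have "\<dots> = sup_norm S g"
      unfolding sup_norm_def by (intro SUP_cong refl) (simp add: pull_fun_def QT r_Q_value g)
    finally show ?thesis .
  qed
  with bij lin show "isometric (rkhs S G) (sup_norm S) (rkhs T K) (sup_norm T)"
    unfolding isometric_def by (intro exI[of _ "pull_fun T r"]) simp
qed

theorem lemma4p1: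
  fixes M :: "'w measure" and W :: "real^'n \<Rightarrow> 'w \<Rightarrow> real"
    and K :: "real^'n \<Rightarrow> real^'n \<Rightarrow> real"
    and Q :: "real^'m \<Rightarrow> real^'n"
    and G :: "real^'m \<Rightarrow> real^'m \<Rightarrow> real"
  assumes "CARD('n) \<ge> 2" and "CARD('m) = CARD('n) - 1"
    and "gaussian_process M (sphere 0 1) W"
    and "has_covariance_kernel M (sphere 0 1) W K"
    and "Q ` cbox 0 1 = sphere 0 1"
    and "\<And>s1 s2. s1 \<in> cbox 0 1 \<Longrightarrow> s2 \<in> cbox 0 1 \<Longrightarrow> G s1 s2 = K (Q s1) (Q s2)"
  shows "isometric (rkhs (cbox 0 1) G) (rkhs_norm (cbox 0 1) G)
                   (rkhs (sphere 0 1) K) (rkhs_norm (sphere 0 1) K)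
       \<and> isometric (rkhs (cbox 0 1) G) (sup_norm (cbox 0 1))
                   (rkhs (sphere 0 1) K) (sup_norm (sphere 0 1))"
  using rkhs_reindex_isometric[OF covariance_kernel_psd[OF assms(3,4)] assms(5,6)] by blast

end
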